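(* Let $p,q\ge 1$ be integers, $d=p+q$, and let $\Sigma_1\in\mathbb{S}^p_{\ge}$ and $\Sigma_2\in\mathbb{S}^q_{\ge}$ have eigendecompositions $\Sigma_j=U_j\Lambda_jU_j^\top$, $j\in\{1,2\}$, where $U_1\in\mathbb{R}^{p\times p}$, $U_2\in\mathbb{R}^{q\times q}$ are orthogonal, $\Lambda_1=\operatorname{diag}(\lambda_{1,1},\dots,\lambda_{p,1})$ with $\lambda_{1,1}\ge\dots\ge\lambda_{p,1}\ge 0$, and $\Lambda_2=\operatorname{diag}(\lambda_{1,2},\dots,\lambda_{q,2})$ with $\lambda_{1,2}\ge\dots\ge\lambda_{q,2}\ge0$. Define the $d\times d$ matrix $$\Sigma_m=\begin{bmatrix}\Sigma_1&\Psi_m\\ \Psi_m^\top&\Sigma_2\end{bmatrix},\qquad \Psi_m=U_1\Lambda_1^{1/2}\,\Pi\,\Lambda_2^{1/2}U_2^\top\in\mathbb{R}^{p\times q},$$ where $\Pi\in\mathbb{R}^{p\times q}$ is the $p\times q$ upper left block of the identity matrix $I_d$. Then the eigenvalues of $\Sigma_m$ (counting multiplicities) are $$\lambda(\Sigma_m)=(\lambda_{j,1}+\lambda_{j,2})_{j=1}^d,$$ where $\lambda_{j,1}=0$ if $j\ge p+1$ and $\lambda_{j,2}=0$ if $j\ge q+1$. Moreover, for any $\Sigma\in\Gamma(\Sigma_1,\Sigma_2)$ with vector of eigenvalues $\lambda(\Sigma)=(\lambda_j)_{j=1}^d$, we have $$\lambda(\Sigma)\prec\lambda(\Sigma_m)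.$$
   Context: $\mathbb{S}^m_{\ge}$ is the set of real symmetric positive semi-definite $m\times m$ matrices. For $\Sigma_1\in\mathbb{S}^p_\ge$, $\Sigma_2\in\mathbb{S}^q_\ge$ and $d=p+q$, $\Gamma(\Sigma_1,\Sigma_2)$ is the set of all $\Sigma\in\mathbb{S}^d_{\ge}$ of the form $\Sigma=\begin{bmatrix}\Sigma_1&\Psi\\ \Psi^\top&\Sigma_2\end{bmatrix}$ for some $\Psi\in\mathbb{R}^{p\times q}$. Majorization: for $x,y\in\mathbb{R}^d$, write $x\prec y$ ($y$ majorizes $x$) if $\sum_{i=1}^k x_{[i]}\le\sum_{i=1}^k y_{[i]}$ for $k=1,\dots,d-1$ and $\sum_{i=1}^d x_{[i]}=\sum_{i=1}^d y_{[i]}$, where $x_{[1]}\ge\dots\ge x_{[d]}$ are the elements of $x$ in decreasing order, and similarly for $y$. *)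

theory Defs
  imports Complex_Main "Jordan_Normal_Form.Char_Poly"
begin

definition psd_mat :: "nat \<Rightarrow> real mat set" where
  "psd_mat n = {A \<in> carrier_mat n n. transpose_mat A = A \<and>
     (\<forall>v \<in> carrier_vec n. 0 \<le> v \<bullet> (A *\<^sub>v v))}"

(* The library's orthogonal_mat only requires the columns to be nonzero and pairwise
   orthogonal; here they have to be orthonormal. *)
definition orthonormal_mat :: "nat \<Rightarrow> real mat set" where
  "orthonormal_mat n = {U \<in> carrier_mat n n. transpose_mat U * U = 1\<^sub>m n}"

definition coupling_set :: "nat \<Rightarrow> nat \<Rightarrow> real mat \<Rightarrow> real mat \<Rightarrow> real mat set" where
  "coupling_set p q S1 S2 = {S \<in> psd_mat (p + q).
     \<exists>Psi \<in> carrier_mat p q. S = four_block_mat S1 Psi (transpose_mat Psi) S2}"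

definition upper_left_identity :: "nat \<Rightarrow> nat \<Rightarrow> real mat" where
  "upper_left_identity p q = mat p q (\<lambda>(i, j). 1\<^sub>m (p + q) $$ (i, j))"

definition decreasing :: "real list \<Rightarrow> real list" where
  "decreasing xs = rev (sort xs)"

(* The vector of real eigenvalues, repeated according to algebraic multiplicity and in
   decreasing order. For a symmetric n x n matrix it has length n. *)
definition eigvals :: "real mat \<Rightarrow> real list" where
  "eigvals A = rev (sorted_list_of_multiset (proots (char_poly A)))"

definition majorized :: "real list \<Rightarrow> real list \<Rightarrow> bool" (infix "\<prec>\<^sub>m" 50) where
  "x \<prec>\<^sub>m y \<longleftrightarrow> length x = length y \<and>
     (\<forall>k \<in> {1..<length x}. (\<Sum>i<k. decreasing x ! i) \<le> (\<Sum>i<k. decreasing y ! i)) \<and>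
     (\<Sum>i<length x. decreasing x ! i) = (\<Sum>i<length y. decreasing y ! i)"

end

theory Submission
  imports Defs
begin

text \<open>
  The proof rests on the two Gram matrices \<open>X * X\<^sup>T\<close> and \<open>X\<^sup>T * X\<close> of a square matrix \<open>X\<close>, which have the
  same spectrum. A positive semidefinite matrix \<open>\<Sigma>\<close> with diagonal blocks \<open>\<Sigma>\<^sub>1\<close>, \<open>\<Sigma>\<^sub>2\<close> can be written as
  \<open>X * X\<^sup>T\<close>; if \<open>A\<close> and \<open>B\<close> are the upper \<open>p\<close> and lower \<open>q\<close> rows of \<open>X\<close>, then \<open>A * A\<^sup>T = \<Sigma>\<^sub>1\<close>,
  \<open>B * B\<^sup>T = \<Sigma>\<^sub>2\<close> and \<open>X\<^sup>T * X = A\<^sup>T * A + B\<^sup>T * B\<close>. So the spectrum of a coupling is the spectrum of a sum of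
  two matrices with the nonzero eigenvalues of \<open>\<Sigma>\<^sub>1\<close> and \<open>\<Sigma>\<^sub>2\<close>, and it spreads out most when the two
  are diagonal in the same basis with the same ordering.

  For \<open>\<Sigma>\<^sub>m\<close> that is the case: there is an explicit \<open>X\<close> for which \<open>A\<^sup>T * A\<close> and \<open>B\<^sup>T * B\<close> are the padded
  diagonal matrices themselves, which yields its eigenvalues (\<open>eigvals_comonotone_coupling\<close>).

  For an arbitrary coupling, the spectral theorem provides an \<open>X\<close> with \<open>X\<^sup>T * X\<close> diagonal
  (\<open>psd_mat_gram\<close>), so the eigenvalues are the sums of the diagonal entries of \<open>A\<^sup>T * A\<close> and \<open>B\<^sup>T * B\<close>.
  The sum of any \<open>k\<close> diagonal entries of \<open>A\<^sup>T * A\<close> is at most the sum of the \<open>k\<close> largest eigenvalues of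
  \<open>A * A\<^sup>T\<close>, by Bessel's inequality (\<open>diagonal_gram_bound\<close>), and likewise for \<open>B\<close>. Adding the two
  bounds gives the majorization; the totals agree because both are the trace.
\<close>

section \<open>Spectra of Gram matrices\<close>

lemma char_poly_lower_block_triangular:
  fixes A :: "'a :: idom mat"
  assumes A: "A \<in> carrier_mat n n" and C: "C \<in> carrier_mat m n" and D: "D \<in> carrier_mat m m"
  shows "char_poly (four_block_mat A (0\<^sub>m n m) C D) = char_poly A * char_poly D"
proof -
  let ?cm = "\<lambda>A. [:0, 1:] \<cdot>\<^sub>m 1\<^sub>m (dim_row A) + map_mat (\<lambda>a. [:- a:]) A"
  have "?cm (four_block_mat A (0\<^sub>m n m) C D)
      = four_block_mat (?cm A) (0\<^sub>m n m) (map_mat (\<lambda>a. [:- a:]) C) (?cm D)"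
    by (rule eq_matI) (use A C D in \<open>auto simp: one_poly_def\<close>)
  also have "det \<dots> = det (?cm A) * det (?cm D)"
    by (rule det_four_block_mat_upper_right_zero[OF _ refl]) (use A C D in auto)
  finally show ?thesis
    unfolding char_poly_defs using A D by simp
qed

text \<open>
  If \<open>A\<close> is invertible, then \<open>A * B\<close> and \<open>B * A\<close> are similar through \<open>A\<close>. In general they need not be
  similar, but each is a diagonal block of a block triangular matrix, \<open>M\<close> or \<open>N\<close> below, whose other
  diagonal block is zero, and conjugation with the unipotent matrix \<open>P\<close> turns \<open>N\<close> into \<open>M\<close>. The zero
  block contributes the same nonzero factor to both characteristic polynomials, which cancels.
\<close>

lemma char_poly_mult_commute:
  fixes A B :: "'a :: idom mat"
  assumes A: "A \<in> carrier_mat n n" and B: "B \<in> carrier_mat n n"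
  shows "char_poly (A * B) = char_poly (B * A)"
proof -
  let ?Z = "0\<^sub>m n n :: 'a mat" and ?I = "1\<^sub>m n :: 'a mat"
  define M where "M = four_block_mat (A * B) ?Z B ?Z"
  define N where "N = four_block_mat ?Z ?Z B (B * A)"
  define P where "P = four_block_mat ?I A ?Z ?I"
  define Q where "Q = four_block_mat ?I (- A) ?Z ?I"
  have carrier: "M \<in> carrier_mat (n + n) (n + n)" "N \<in> carrier_mat (n + n) (n + n)"
      "P \<in> carrier_mat (n + n) (n + n)" "Q \<in> carrier_mat (n + n) (n + n)"
    unfolding M_def N_def P_def Q_def using A B by auto
  have neg_zero: "- ?Z = ?Z" by (rule eq_matI) auto
  have add_neg: "A + - A = ?Z" "- A + A = ?Z" using A by (auto intro!: eq_matI)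
  have PQ: "P * Q = 1\<^sub>m (n + n)"
    unfolding P_def Q_def using A
    by (subst mult_four_block_mat[of _ n n _ n _ n _ _ n _ n]) (auto simp: add_neg neg_zero)
  have QP: "Q * P = 1\<^sub>m (n + n)"
    unfolding P_def Q_def using A
    by (subst mult_four_block_mat[of _ n n _ n _ n _ _ n _ n]) (auto simp: add_neg neg_zero)
  have MP: "M * P = four_block_mat (A * B) (A * B * A) B (B * A)"
    unfolding M_def P_def using A B
    by (subst mult_four_block_mat[of _ n n _ n _ n _ _ n _ n]) auto
  have PN: "P * N = four_block_mat (A * B) (A * B * A) B (B * A)"
    unfolding N_def P_def using A B
    by (subst mult_four_block_mat[of _ n n _ n _ n _ _ n _ n]) auto
  have "P * N * Q = M * P * Q" using MP PN by simp
  also have "\<dots> = M" using carrier PQ by (simp add: assoc_mult_mat[of _ "n+n" "n+n" _ "n+n" _ "n+n"])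
  finally have "similar_mat_wit M N P Q"
    using carrier PQ QP by (intro similar_mat_witI[of _ _ "n+n"]) auto
  then have "char_poly M = char_poly N"
    by (intro char_poly_similar) (auto simp: similar_mat_def)
  moreover have "char_poly M = char_poly (A * B) * char_poly ?Z"
    unfolding M_def using A B by (intro char_poly_lower_block_triangular) auto
  moreover have "char_poly N = char_poly ?Z * char_poly (B * A)"
    unfolding N_def using A B by (intro char_poly_lower_block_triangular) auto
  moreover have "char_poly ?Z \<noteq> 0"
    using degree_monic_char_poly[of ?Z n] by auto
  ultimately show ?thesis by simp
qed

lemma eigvals_of_linear_factors:
  assumes "char_poly A = (\<Prod>a\<leftarrow>as. [:- a, 1:])"
  shows "eigvals A = rev (sort as)"
proof -
  have "(\<Prod>a\<leftarrow>as. [:- a, 1:]) \<noteq> 0" for as :: "real list"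
    by (auto simp: prod_list_zero_iff)
  then have "proots (char_poly A) = mset as"
    unfolding assms by (induction as) (simp_all add: proots_mult del: mult_pCons_left)
  then show ?thesis by (simp add: eigvals_def)
qed

text \<open>
  Both halves of the main theorem read off eigenvalues through this lemma: a factorization
  \<open>S = X * X\<^sup>T\<close> whose other Gram matrix \<open>X\<^sup>T * X\<close> is diagonal displays the whole spectrum of \<open>S\<close>.
\<close>

lemma eigvals_gram:
  assumes X: "X \<in> carrier_mat n n" and D: "transpose_mat X * X = mat_diag n l"
  shows "eigvals (X * transpose_mat X) = rev (sort (map l [0..<n]))"
proof (rule eigvals_of_linear_factors)
  have "char_poly (X * transpose_mat X) = char_poly (mat_diag n l)"
    unfolding D[symmetric] using X by (intro char_poly_mult_commute) auto
  also have "\<dots> = (\<Prod>a\<leftarrow>diag_mat (mat_diag n l). [:- a, 1:])"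
    by (rule char_poly_upper_triangular[of _ n]) (auto simp: mat_diag_def)
  also have "diag_mat (mat_diag n l) = map l [0..<n]"
    by (auto simp: diag_mat_def mat_diag_def)
  finally show "char_poly (X * transpose_mat X) = (\<Prod>a\<leftarrow>map l [0..<n]. [:- a, 1:])" .
qed

section \<open>The spectral theorem for real symmetric matrices\<close>

text \<open>
  A complex eigenvector \<open>x + i y\<close> exists by the fundamental theorem of algebra. Comparing
  \<open>x \<bullet> A y\<close> with \<open>A x \<bullet> y\<close> shows that the imaginary part of its eigenvalue is annihilated by
  \<open>x \<bullet> x + y \<bullet> y\<close> and so vanishes; then \<open>x\<close> and \<open>y\<close> are themselves real eigenvectors, unless zero.
\<close>

lemma symmetric_real_eigenvector:
  fixes A :: "real mat"
  assumes A: "A \<in> carrier_mat n n" and sym: "transpose_mat A = A" and n: "n > 0"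
  obtains c v where "v \<in> carrier_vec n" "v \<bullet> v = 1" "A *\<^sub>v v = c \<cdot>\<^sub>v v"
proof -
  let ?M = "map_mat complex_of_real A"
  have M: "?M \<in> carrier_mat n n" using A by auto
  obtain as where as: "char_poly ?M = (\<Prod>a\<leftarrow>as. [:- a, 1:])" "length as = n"
    using char_poly_factorized[OF M] by auto
  obtain a where "a \<in> set as" using as(2) n by (cases as) auto
  then have "poly (char_poly ?M) a = 0"
    unfolding as(1) poly_prod_list by (auto simp: prod_list_zero_iff)
  then have "eigenvalue ?M a" using eigenvalue_root_char_poly[OF M] by simp
  then obtain u where u: "u \<in> carrier_vec n" "u \<noteq> 0\<^sub>v n" "?M *\<^sub>v u = a \<cdot>\<^sub>v u"
    using M by (auto simp: eigenvalue_def eigenvector_def)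
  define x where "x = map_vec Re u"
  define y where "y = map_vec Im u"
  have xy: "x \<in> carrier_vec n" "y \<in> carrier_vec n" using u(1) by (auto simp: x_def y_def)
  have Ax: "A *\<^sub>v x = map_vec Re (?M *\<^sub>v u)" and Ay: "A *\<^sub>v y = map_vec Im (?M *\<^sub>v u)"
    using A u(1) by (auto intro!: eq_vecI sum.cong simp: x_def y_def scalar_prod_def)
  have Ax': "A *\<^sub>v x = Re a \<cdot>\<^sub>v x - Im a \<cdot>\<^sub>v y" and Ay': "A *\<^sub>v y = Re a \<cdot>\<^sub>v y + Im a \<cdot>\<^sub>v x"
    unfolding Ax Ay u(3) using u(1) by (auto intro!: eq_vecI simp: x_def y_def)
  have pos: "x \<bullet> x + y \<bullet> y > 0"
  proof -
    obtain i where i: "i < n" "u $ i \<noteq> 0" using u(1,2) by (metis carrier_vecD eq_vecI index_zero_vec)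
    have "0 < (x $ i)\<^sup>2 + (y $ i)\<^sup>2" using i u(1)
      by (simp add: x_def y_def complex_eq_iff sum_power2_gt_zero_iff)
    also have "\<dots> \<le> (\<Sum>i = 0..<n. (x $ i)\<^sup>2 + (y $ i)\<^sup>2)"
      using i by (intro member_le_sum) auto
    also have "\<dots> = x \<bullet> x + y \<bullet> y"
      using xy by (simp add: scalar_prod_def power2_eq_square sum.distrib)
    finally show ?thesis .
  qed
  have "x \<bullet> (A *\<^sub>v y) = (A *\<^sub>v x) \<bullet> y"
    using transpose_vec_mult_scalar[OF A xy(2,1)] xy A unfolding sym
    by (simp add: comm_scalar_prod[of _ n])
  then have "Im a * (x \<bullet> x + y \<bullet> y) = 0"
    unfolding Ax' Ay' using xy
    by (simp add: scalar_prod_add_distrib[of _ n] minus_scalar_prod_distrib[of _ n]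
        comm_scalar_prod[of y n x] distrib_left)
  then have "Im a = 0" using pos by simp
  then have eig: "A *\<^sub>v x = Re a \<cdot>\<^sub>v x" "A *\<^sub>v y = Re a \<cdot>\<^sub>v y"
    unfolding Ax' Ay' using xy by auto
  have "x \<bullet> x > 0 \<or> y \<bullet> y > 0" using pos by linarith
  then obtain z where z: "z \<in> carrier_vec n" "A *\<^sub>v z = Re a \<cdot>\<^sub>v z" "z \<bullet> z > 0"
    using eig xy by metis
  let ?v = "(1 / sqrt (z \<bullet> z)) \<cdot>\<^sub>v z"
  show thesis
  proof (rule that[of ?v "Re a"])
    show "?v \<in> carrier_vec n" using z by simp
    show "?v \<bullet> ?v = 1" using z by (simp add: field_simps flip: power2_eq_square)
    show "A *\<^sub>v ?v = Re a \<cdot>\<^sub>v ?v"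
      using mult_mat_vec[OF A z(1)] z by (simp add: smult_smult_assoc mult.commute)
  qed
qed

text \<open>
  The reflection in the hyperplane orthogonal to \<open>v - e\<^sub>0\<close> swaps \<open>e\<^sub>0\<close> and \<open>v\<close>, because both have
  length 1; if \<open>v = e\<^sub>0\<close>, the identity serves instead. Its columns complete \<open>v\<close> to an orthonormal basis
  by an explicit formula, without an orthogonalization procedure.
\<close>

lemma householder:
  fixes v :: "real vec"
  assumes v: "v \<in> carrier_vec n" "v \<bullet> v = 1" and n: "n > 0"
  obtains H where "H \<in> carrier_mat n n" "transpose_mat H = H" "H * H = 1\<^sub>m n" "col H 0 = v"
proof (cases "v = unit_vec n 0")
  case True
  then show ?thesis using n by (intro that[of "1\<^sub>m n"]) auto
next
  case False
  define w where "w = v - unit_vec n 0"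
  have w: "w \<in> carrier_vec n" using v by (simp add: w_def)
  have ww: "w \<bullet> w = 2 - 2 * v $ 0"
  proof -
    have "w \<bullet> w = v \<bullet> v - v \<bullet> unit_vec n 0 - (unit_vec n 0 \<bullet> v - unit_vec n 0 \<bullet> unit_vec n 0)"
      unfolding w_def using v
      by (simp add: minus_scalar_prod_distrib[of _ n] scalar_prod_minus_distrib[of _ n])
    also have "\<dots> = 2 - 2 * v $ 0" using v n by simp
    finally show ?thesis .
  qed
  have "w \<bullet> w \<noteq> 0"
  proof
    assume "w \<bullet> w = 0"
    then have "w = 0\<^sub>v n" using conjugate_square_eq_0_vec[OF w] by simp
    have "v $ i = unit_vec n 0 $ i" if i: "i < n" for i
    proof -
      have "v $ i - unit_vec n 0 $ i = w $ i" using i v by (simp add: w_def)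
      also have "\<dots> = 0" using \<open>w = 0\<^sub>v n\<close> i by simp
      finally show ?thesis by simp
    qed
    then have "v = unit_vec n 0" using v by (intro eq_vecI) auto
    with False show False ..
  qed
  then have v0: "v $ 0 \<noteq> 1" using ww by auto
  define c where "c = 2 / (w \<bullet> w)"
  define H where "H = mat n n (\<lambda>(i, j). (if i = j then 1 else 0) - c * w $ i * w $ j)"
  show thesis
  proof (rule that[of H])
    show "H \<in> carrier_mat n n" by (simp add: H_def)
    show "transpose_mat H = H" by (rule eq_matI) (auto simp: H_def)
    show "H * H = 1\<^sub>m n"
    proof (rule eq_matI)
      fix i j assume "i < dim_row (1\<^sub>m n :: real mat)" "j < dim_col (1\<^sub>m n :: real mat)"
      then have ij: "i < n" "j < n" by auto
      have "(H * H) $$ (i, j) = (\<Sum>k = 0..<n.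
          ((if i = k then 1 else 0) - c * w $ i * w $ k) * ((if k = j then 1 else 0) - c * w $ k * w $ j))"
        using ij by (simp add: H_def scalar_prod_def)
      also have "\<dots> = (\<Sum>k = 0..<n. (if k = i then (if k = j then 1 else 0) - c * w $ k * w $ j else 0)
          - (if k = j then c * w $ i * w $ k else 0) + c * c * w $ i * w $ j * (w $ k * w $ k))"
        by (rule sum.cong) (auto simp: algebra_simps)
      also have "\<dots> = (if i = j then 1 else 0) - 2 * c * w $ i * w $ j
          + c * c * w $ i * w $ j * (w \<bullet> w)"
        using ij w
        by (simp add: sum.distrib sum_subtractf sum.delta scalar_prod_def flip: sum_distrib_left)
      \<comment> \<open>The choice of \<open>c\<close> makes the quadratic term cancel the linear one: \<open>c * (w \<bullet> w) = 2\<close>.\<close>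
      also have "\<dots> = (if i = j then 1 else 0)"
        using \<open>w \<bullet> w \<noteq> 0\<close> by (simp add: c_def)
      finally show "(H * H) $$ (i, j) = 1\<^sub>m n $$ (i, j)" using ij by simp
    qed (auto simp: H_def)
    show "col H 0 = v"
    proof (rule eq_vecI)
      fix i assume "i < dim_vec v"
      then have i: "i < n" using v by simp
      have "c * (v $ 0 - 1) = - 1"
        unfolding c_def ww using v0 by (simp add: field_simps)
      moreover have "w $ 0 = v $ 0 - 1"
        using n v by (simp add: w_def)
      ultimately have "c * w $ i * w $ 0 = - w $ i"
        by (metis mult.assoc mult.commute mult_minus1)
      then show "col H 0 $ i = v $ i" using i n v by (auto simp: H_def w_def)
    qed (use v in \<open>auto simp: H_def\<close>)
  qed
qed

lemma orthonormal_matD: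
  assumes "U \<in> orthonormal_mat n"
  shows "U \<in> carrier_mat n n" "transpose_mat U * U = 1\<^sub>m n" "U * transpose_mat U = 1\<^sub>m n"
  using assms mat_mult_left_right_inverse[of "transpose_mat U" n U]
  by (auto simp: orthonormal_mat_def)

text \<open>
  Deflation: a symmetric orthogonal matrix whose first column is a unit eigenvector conjugates \<open>A\<close>
  into a matrix whose first column is a multiple of \<open>e\<^sub>0\<close>; by symmetry so is the first row, and the remaining block is a
  smaller symmetric matrix.
\<close>

theorem spectral_theorem:
  fixes A :: "real mat"
  assumes "A \<in> carrier_mat n n" and "transpose_mat A = A"
  shows "\<exists>U \<in> orthonormal_mat n. \<exists>l. A = U * mat_diag n l * transpose_mat U"
  using assms
proof (induction n arbitrary: A)
  case 0
  then show ?case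
    by (intro bexI[of _ "1\<^sub>m 0"]) (auto simp: orthonormal_mat_def intro!: eq_matI)
next
  case (Suc n)
  let ?N = "Suc n"
  note A = Suc.prems(1)
  obtain c v where v: "v \<in> carrier_vec ?N" "v \<bullet> v = 1" "A *\<^sub>v v = c \<cdot>\<^sub>v v"
    using symmetric_real_eigenvector[OF Suc.prems] by blast
  obtain H where H: "H \<in> carrier_mat ?N ?N" "transpose_mat H = H" "H * H = 1\<^sub>m ?N" "col H 0 = v"
    using householder[OF v(1,2)] by blast
  define B where "B = H * A * H"
  have B: "B \<in> carrier_mat ?N ?N" using A H by (simp add: B_def)
  have B_sym: "transpose_mat B = B"
    unfolding B_def using A H Suc.prems(2)
    by (simp add: transpose_mult[of _ ?N ?N _ ?N] assoc_mult_mat[of _ ?N ?N _ ?N _ ?N])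
  have "col B 0 = H *\<^sub>v (A *\<^sub>v v)"
    unfolding B_def col_mult2[OF mult_carrier_mat[OF H(1) A] H(1) zero_less_Suc] H(4)
    by (rule assoc_mult_mat_vec[OF H(1) A v(1)])
  also have "\<dots> = c \<cdot>\<^sub>v (H *\<^sub>v v)"
    unfolding v(3) using mult_mat_vec[OF H(1) v(1)] .
  also have "H *\<^sub>v v = col (H * H) 0"
    unfolding col_mult2[OF H(1) H(1) zero_less_Suc] H(4) ..
  finally have B_col: "col B 0 = c \<cdot>\<^sub>v unit_vec ?N 0" unfolding H(3) by simp
  have B_entry: "B $$ (i, 0) = (if i = 0 then c else 0)" "B $$ (0, i) = (if i = 0 then c else 0)"
    if "i < ?N" for i
  proof -
    show *: "B $$ (i, 0) = (if i = 0 then c else 0)"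
      using arg_cong[OF B_col, of "\<lambda>v. v $ i"] that B by auto
    have "B $$ (0, i) = transpose_mat B $$ (i, 0)" using that B by auto
    then show "B $$ (0, i) = (if i = 0 then c else 0)" using * B_sym by simp
  qed
  define A' where "A' = mat n n (\<lambda>(i, j). B $$ (Suc i, Suc j))"
  have B_sym_entry: "B $$ (i, j) = B $$ (j, i)" if "i < ?N" "j < ?N" for i j
    using arg_cong[OF B_sym, of "\<lambda>B. B $$ (i, j)"] that B by simp
  have A': "A' \<in> carrier_mat n n" "transpose_mat A' = A'"
    by (auto simp: A'_def intro!: eq_matI B_sym_entry)
  obtain V l where V: "V \<in> orthonormal_mat n" and A'_eq: "A' = V * mat_diag n l * transpose_mat V"
    using Suc.IH[OF A'] by blast
  note V' = orthonormal_matD[OF V]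
  let ?one = "1\<^sub>m 1 :: real mat" and ?r = "0\<^sub>m 1 n :: real mat" and ?c = "0\<^sub>m n 1 :: real mat"
  define W where "W = four_block_mat ?one ?r ?c V"
  have W: "W \<in> carrier_mat ?N ?N" 
    using four_block_carrier_mat[of ?one 1 1 V n n ?r ?c] V' by (simp add: W_def)
  have Wt: "transpose_mat W = four_block_mat ?one ?r ?c (transpose_mat V)"
    unfolding W_def using V' by (subst transpose_four_block_mat[of _ 1 1 _ n _ n]) auto
  have WW: "transpose_mat W * W = 1\<^sub>m ?N"
    unfolding Wt unfolding W_def using V'
    by (subst mult_four_block_mat[of _ 1 1 _ n _ n _ _ 1 _ n]) auto
  let ?l = "\<lambda>i. if i = 0 then c else l (i - 1)"
  let ?C = "mat 1 1 (\<lambda>_. c)"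
  have diag: "mat_diag ?N ?l = four_block_mat ?C ?r ?c (mat_diag n l)"
    by (rule eq_matI) (auto simp: mat_diag_def)
  have VD: "V * mat_diag n l \<in> carrier_mat n n" using V' by simp
  have VDV: "V * mat_diag n l * transpose_mat V \<in> carrier_mat n n"
    using VD V' by (intro mult_carrier_mat[of _ n n]) auto
  have "W * mat_diag ?N ?l = four_block_mat ?C ?r ?c (V * mat_diag n l)"
    unfolding diag W_def using V'
    by (subst mult_four_block_mat[of _ 1 1 _ n _ n _ _ 1 _ n])
      (auto simp: left_mult_zero_mat[OF mat_diag_dim])
  moreover have "\<dots> * transpose_mat W = four_block_mat ?C ?r ?c A'"
    unfolding Wt A'_eq using V'
    by (subst mult_four_block_mat[of _ 1 1 _ n _ n _ _ 1 _ n])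
      (auto simp: right_mult_zero_mat[OF VD] left_add_zero_mat[OF VDV])
  ultimately have "W * mat_diag ?N ?l * transpose_mat W = four_block_mat ?C ?r ?c A'"
    by simp
  also have "\<dots> = B"
    using B by (auto intro!: eq_matI simp: B_entry A'_def)
  finally have B_eq: "B = W * mat_diag ?N ?l * transpose_mat W" ..
  have "A = (H * H) * A * (H * H)" using A H(3) by simp
  also have "\<dots> = H * B * H" unfolding B_def using A H(1)
    by (simp add: assoc_mult_mat[of _ ?N ?N _ ?N _ ?N])
  also have "\<dots> = (H * W) * mat_diag ?N ?l * (transpose_mat W * transpose_mat H)"
    unfolding B_eq using A H(1,2) W
    by (simp add: assoc_mult_mat[of _ ?N ?N _ ?N _ ?N] mult_carrier_mat[of _ ?N ?N _ ?N])
  also have "transpose_mat W * transpose_mat H = transpose_mat (H * W)"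
    using H(1) W by (simp add: transpose_mult[of _ ?N ?N _ ?N])
  finally have A_eq: "A = (H * W) * mat_diag ?N ?l * transpose_mat (H * W)" .
  have "transpose_mat (H * W) * (H * W) = transpose_mat W * (H * H) * W"
    using H(1,2) W by (simp add: transpose_mult[of _ ?N ?N _ ?N] assoc_mult_mat[of _ ?N ?N _ ?N _ ?N])
  then have "H * W \<in> orthonormal_mat ?N"
    using H W WW by (auto simp: orthonormal_mat_def)
  with A_eq show ?case by blast
qed

text \<open>
  If \<open>U\<close> diagonalizes \<open>S\<close>, then scaling its columns by the square roots of the eigenvalues gives \<open>X\<close>.
  Positivity of \<open>S\<close> enters because the \<open>i\<close>-th eigenvalue is the value of the quadratic form at the
  \<open>i\<close>-th column of \<open>U\<close>.
\<close>

lemma psd_mat_gram: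
  assumes S: "S \<in> psd_mat n"
  obtains X l where "X \<in> carrier_mat n n" "S = X * transpose_mat X"
    "transpose_mat X * X = mat_diag n l"
proof -
  have S': "S \<in> carrier_mat n n" "transpose_mat S = S"
    and psd: "\<And>v. v \<in> carrier_vec n \<Longrightarrow> 0 \<le> v \<bullet> (S *\<^sub>v v)"
    using S by (auto simp: psd_mat_def)
  obtain U l where U: "U \<in> orthonormal_mat n" and S_eq: "S = U * mat_diag n l * transpose_mat U"
    using spectral_theorem[OF S'] by blast
  note U' = orthonormal_matD[OF U]
  note assoc = assoc_mult_mat[of _ n n _ n _ n]
  have "transpose_mat U * (S * U) = (transpose_mat U * U) * mat_diag n l * (transpose_mat U * U)"
    unfolding S_eq using U'(1) by (simp add: assoc mult_carrier_mat[of _ n n _ n])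
  then have diag: "transpose_mat U * (S * U) = mat_diag n l"
    using U' by (simp add: left_mult_one_mat[OF mat_diag_dim] right_mult_one_mat[OF mat_diag_dim])
  have l: "0 \<le> l i" if i: "i < n" for i
  proof -
    have "l i = (transpose_mat U * (S * U)) $$ (i, i)"
      unfolding diag using i by (simp add: mat_diag_def)
    also have "\<dots> = col U i \<bullet> (S *\<^sub>v col U i)"
      using i U'(1) S'(1) by (simp add: mult_mat_vec_def)
    also have "\<dots> \<ge> 0" using i U'(1) by (intro psd) (auto simp: col_dim)
    finally show ?thesis .
  qed
  let ?D = "mat_diag n (\<lambda>i. sqrt (l i))"
  have Dt: "transpose_mat ?D = ?D" by (rule eq_matI) (auto simp: mat_diag_def)
  have DD: "?D * ?D = mat_diag n l"
    unfolding mat_diag_diag by (rule eq_matI) (auto simp: mat_diag_def l)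
  have Xt: "transpose_mat (U * ?D) = ?D * transpose_mat U"
    using U'(1) by (simp add: transpose_mult[of _ n n _ n] Dt)
  show thesis
  proof (rule that[of "U * ?D" l])
    show "U * ?D \<in> carrier_mat n n" using U'(1) by simp
    have "U * ?D * transpose_mat (U * ?D) = U * (?D * ?D) * transpose_mat U"
      unfolding Xt using U'(1) by (simp add: assoc mult_carrier_mat[of _ n n _ n] del: mat_diag_diag)
    then show "S = U * ?D * transpose_mat (U * ?D)" unfolding DD S_eq by simp
    have "transpose_mat (U * ?D) * (U * ?D) = ?D * (transpose_mat U * U) * ?D"
      unfolding Xt using U'(1) by (simp add: assoc mult_carrier_mat[of _ n n _ n] del: mat_diag_diag)
    then show "transpose_mat (U * ?D) * (U * ?D) = mat_diag n l"
      unfolding U'(2) right_mult_one_mat[OF mat_diag_dim] DD .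
  qed
qed

section \<open>Diagonal entries of a Gram matrix\<close>

definition zero_pad :: "nat \<Rightarrow> (nat \<Rightarrow> real) \<Rightarrow> nat \<Rightarrow> real" where
  "zero_pad p l i = (if i < p then l i else 0)"

lemma index_mult_mat_sum:
  assumes "A \<in> carrier_mat n m" "B \<in> carrier_mat m r" "i < n" "j < r"
  shows "(A * B) $$ (i, j) = (\<Sum>k<m. A $$ (i, k) * B $$ (k, j))"
  using assms by (simp add: scalar_prod_def lessThan_atLeast0)

text \<open>
  With weights at most 1 and total weight at most \<open>k\<close>, a weighted sum is largest when the weight sits
  on the \<open>k\<close> largest entries. For \<open>k < p\<close>, any other choice takes weight away from entries that are at
  least \<open>l k\<close> and places no more than that amount on entries that are at most \<open>l k\<close>; so \<open>l\<close> may
  be replaced by the constant \<open>l k\<close> when the two choices are compared.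
\<close>

lemma weighted_sum_le_top_sum:
  fixes l w :: "nat \<Rightarrow> real"
  assumes decr: "\<And>i j. i \<le> j \<Longrightarrow> j < p \<Longrightarrow> l j \<le> l i" and nonneg: "\<And>i. i < p \<Longrightarrow> 0 \<le> l i"
    and w: "\<And>i. i < p \<Longrightarrow> 0 \<le> w i" "\<And>i. i < p \<Longrightarrow> w i \<le> 1" and sum_w: "(\<Sum>i<p. w i) \<le> real k"
  shows "(\<Sum>i<p. l i * w i) \<le> (\<Sum>i<k. zero_pad p l i)"
proof (cases "k < p")
  case False
  have "(\<Sum>i<p. l i * w i) \<le> (\<Sum>i<p. l i)"
    using w(2) nonneg by (intro sum_mono) (auto intro: mult_left_le)
  also have "\<dots> = (\<Sum>i<p. zero_pad p l i)"
    by (rule sum.cong) (auto simp: zero_pad_def)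
  also have "\<dots> = (\<Sum>i<k. zero_pad p l i)"
    using False by (intro sum.mono_neutral_left) (auto simp: zero_pad_def)
  finally show ?thesis .
next
  case True
  let ?e = "\<lambda>i. if i < k then 1 else 0 :: real"
  have restrict: "(\<Sum>i<p. f i * ?e i) = (\<Sum>i<k. f i)" for f :: "nat \<Rightarrow> real"
    using True by (intro sum.mono_neutral_cong_right) auto
  have "(\<Sum>i<p. l i * (w i - ?e i)) \<le> (\<Sum>i<p. l k * (w i - ?e i))"
  proof (rule sum_mono)
    fix i assume "i \<in> {..<p}"
    then show "l i * (w i - ?e i) \<le> l k * (w i - ?e i)"
      using w[of i] True decr[of i k] decr[of k i]
      by (cases "i < k") (auto intro: mult_right_mono mult_right_mono_neg)
  qed
  also have "\<dots> = l k * ((\<Sum>i<p. w i) - real k)"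
    using restrict[of "\<lambda>_. 1"] by (simp add: sum_subtractf flip: sum_distrib_left)
  also have "\<dots> \<le> 0" using nonneg[OF True] sum_w by (simp add: mult_nonneg_nonpos)
  finally have "(\<Sum>i<p. l i * w i) \<le> (\<Sum>i<k. l i)"
    using restrict[of l] by (simp add: right_diff_distrib sum_subtractf)
  also have "\<dots> = (\<Sum>i<k. zero_pad p l i)"
    using True by (intro sum.cong) (auto simp: zero_pad_def)
  finally show ?thesis .
qed

text \<open>
  The rows of \<open>C\<close> are orthogonal with squared lengths \<open>l i\<close>, and the diagonal of \<open>C\<^sup>T * C\<close> consists of
  the squared lengths of its columns. The columns in \<open>J\<close> therefore carry \<open>\<Sum>i. l i * w i\<close>, where \<open>w i\<close>
  is the fraction of the squared length of row \<open>i\<close> that lies in \<open>J\<close>. Each fraction is at most 1, and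
  by Bessel's inequality for the normalized rows, applied to the unit vectors \<open>e\<^sub>j\<close> with \<open>j \<in> J\<close>, the
  fractions add up to at most \<open>card J\<close>.
\<close>

lemma diagonal_gram_bound:
  fixes C :: "real mat"
  assumes C: "C \<in> carrier_mat p n" and gram: "C * transpose_mat C = mat_diag p l"
    and decr: "\<And>i j. i \<le> j \<Longrightarrow> j < p \<Longrightarrow> l j \<le> l i" and nonneg: "\<And>i. i < p \<Longrightarrow> 0 \<le> l i"
  shows "J \<subseteq> {..<n} \<Longrightarrow>
      (\<Sum>j\<in>J. (transpose_mat C * C) $$ (j, j)) \<le> (\<Sum>i<card J. zero_pad p l i)"
    and "(\<Sum>j<n. (transpose_mat C * C) $$ (j, j)) = (\<Sum>i<p. l i)"
proof -
  have orth: "(\<Sum>j<n. C $$ (i, j) * C $$ (i', j)) = (if i = i' then l i else 0)"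
    if "i < p" "i' < p" for i i'
    using arg_cong[OF gram, of "\<lambda>M. M $$ (i, i')"] that C
    by (simp add: index_mult_mat_sum[of _ p n _ p] mat_diag_def del: index_mult_mat)
  have diag: "(transpose_mat C * C) $$ (j, j) = (\<Sum>i<p. (C $$ (i, j))\<^sup>2)" if "j < n" for j
    using that C
    by (simp add: index_mult_mat_sum[of _ n p _ n] power2_eq_square del: index_mult_mat)
  have row: "(\<Sum>j<n. (C $$ (i, j))\<^sup>2) = l i" if "i < p" for i
    using orth[OF that that] by (simp add: power2_eq_square)
  have "(\<Sum>j<n. (transpose_mat C * C) $$ (j, j)) = (\<Sum>j<n. \<Sum>i<p. (C $$ (i, j))\<^sup>2)"
    by (simp add: diag)
  also have "\<dots> = (\<Sum>i<p. l i)" by (subst sum.swap) (simp add: row)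
  finally show "(\<Sum>j<n. (transpose_mat C * C) $$ (j, j)) = (\<Sum>i<p. l i)" .

  have bessel: "(\<Sum>i<p. (C $$ (i, j))\<^sup>2 / l i) \<le> 1" if j: "j < n" for j
  proof -
    \<comment> \<open>The sum \<open>s\<close> is both the \<open>j\<close>-th coordinate and the squared norm of the projection of \<open>e\<^sub>j\<close>
      to the span of the rows, so \<open>s\<^sup>2 \<le> s\<close>. Zero rows drop out since division by 0 gives 0.\<close>
    let ?u = "\<lambda>i. C $$ (i, j) / l i"
    define s where "s = (\<Sum>i<p. (C $$ (i, j))\<^sup>2 / l i)"
    have "s\<^sup>2 = (\<Sum>i<p. ?u i * C $$ (i, j))\<^sup>2"
      by (simp add: s_def power2_eq_square)
    also have "\<dots> \<le> (\<Sum>m<n. (\<Sum>i<p. ?u i * C $$ (i, m))\<^sup>2)"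
      using j by (intro member_le_sum) auto
    also have "\<dots> = (\<Sum>m<n. \<Sum>i<p. \<Sum>i'<p. ?u i * ?u i' * (C $$ (i, m) * C $$ (i', m)))"
      by (simp add: power2_eq_square sum_product mult_ac)
    also have "\<dots> = (\<Sum>i<p. \<Sum>i'<p. \<Sum>m<n. ?u i * ?u i' * (C $$ (i, m) * C $$ (i', m)))"
      by (subst sum.swap, rule sum.cong[OF refl], rule sum.swap)
    also have "\<dots> = (\<Sum>i<p. \<Sum>i'<p. if i' = i then ?u i * ?u i * l i else 0)"
    proof (intro sum.cong refl)
      fix i i' assume "i \<in> {..<p}" "i' \<in> {..<p}"
      then have "(\<Sum>m<n. ?u i * ?u i' * (C $$ (i, m) * C $$ (i', m)))
          = ?u i * ?u i' * (if i = i' then l i else 0)"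
        unfolding sum_distrib_left[symmetric] by (simp add: orth)
      then show "(\<Sum>m<n. ?u i * ?u i' * (C $$ (i, m) * C $$ (i', m)))
          = (if i' = i then ?u i * ?u i * l i else 0)" by auto
    qed
    also have "\<dots> = s"
      by (auto simp: s_def power2_eq_square intro!: sum.cong)
    finally have "s * s \<le> 1 * s" by (simp add: power2_eq_square)
    then have "s \<le> 1" by (cases "s > 0") auto
    then show ?thesis by (simp add: s_def)
  qed

  assume J: "J \<subseteq> {..<n}"
  then have fin: "finite J" using finite_subset by blast
  define w where "w = (\<lambda>i. (\<Sum>j\<in>J. (C $$ (i, j))\<^sup>2) / l i)"
  have part: "(\<Sum>j\<in>J. (C $$ (i, j))\<^sup>2) \<le> l i" if "i < p" for i
    unfolding row[OF that, symmetric] using J by (intro sum_mono2) auto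
  have lw: "l i * w i = (\<Sum>j\<in>J. (C $$ (i, j))\<^sup>2)" if "i < p" for i
  proof (cases "l i = 0")
    case True
    moreover have "(\<Sum>j\<in>J. (C $$ (i, j))\<^sup>2) \<ge> 0" by (intro sum_nonneg) auto
    ultimately show ?thesis using part[OF that] by simp
  qed (simp add: w_def)
  have "(\<Sum>j\<in>J. (transpose_mat C * C) $$ (j, j)) = (\<Sum>j\<in>J. \<Sum>i<p. (C $$ (i, j))\<^sup>2)"
    using J by (intro sum.cong) (auto simp: diag subset_iff)
  also have "\<dots> = (\<Sum>i<p. l i * w i)"
    by (subst sum.swap) (simp add: lw)
  also have "\<dots> \<le> (\<Sum>i<card J. zero_pad p l i)"
  proof (rule weighted_sum_le_top_sum[OF decr nonneg])
    show "0 \<le> w i" if "i < p" for i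
      using nonneg[OF that] by (auto simp: w_def intro!: divide_nonneg_nonneg sum_nonneg)
    show "w i \<le> 1" if "i < p" for i
      using part[OF that] nonneg[OF that] by (auto simp: w_def divide_le_eq_1)
    have "(\<Sum>i<p. w i) = (\<Sum>j\<in>J. \<Sum>i<p. (C $$ (i, j))\<^sup>2 / l i)"
      unfolding w_def sum_divide_distrib by (rule sum.swap)
    also have "\<dots> \<le> (\<Sum>j\<in>J. 1)"
      using J by (intro sum_mono bessel) auto
    finally show "(\<Sum>i<p. w i) \<le> real (card J)" by simp
  qed
  finally show "(\<Sum>j\<in>J. (transpose_mat C * C) $$ (j, j)) \<le> (\<Sum>i<card J. zero_pad p l i)" .
qed

text \<open>
  Rotating \<open>A\<close> by \<open>U\<^sup>T\<close> from the left makes its rows orthogonal and leaves \<open>A\<^sup>T * A\<close> unchanged.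
\<close>

lemma diagonal_gram_bound_conj:
  fixes A U :: "real mat"
  assumes A: "A \<in> carrier_mat p n" and U: "U \<in> orthonormal_mat p"
    and gram: "A * transpose_mat A = U * mat_diag p l * transpose_mat U"
    and decr: "\<And>i j. i \<le> j \<Longrightarrow> j < p \<Longrightarrow> l j \<le> l i" and nonneg: "\<And>i. i < p \<Longrightarrow> 0 \<le> l i"
  shows "J \<subseteq> {..<n} \<Longrightarrow>
      (\<Sum>j\<in>J. (transpose_mat A * A) $$ (j, j)) \<le> (\<Sum>i<card J. zero_pad p l i)"
    and "(\<Sum>j<n. (transpose_mat A * A) $$ (j, j)) = (\<Sum>i<p. l i)"
proof -
  note U' = orthonormal_matD[OF U]
  let ?C = "transpose_mat U * A"
  have C: "?C \<in> carrier_mat p n" using U' A by simp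
  have Ct: "transpose_mat ?C = transpose_mat A * U"
    using U' A by (simp add: transpose_mult[of _ p p _ n])
  have "?C * transpose_mat ?C = transpose_mat U * (A * transpose_mat A) * U"
    unfolding Ct using U'(1) A
    by (simp add: assoc_mult_mat[of _ p p _ n _ p] assoc_mult_mat[of _ p p _ p _ p]
        assoc_mult_mat[of _ p n _ p _ p])
  also have "\<dots> = (transpose_mat U * U) * mat_diag p l * (transpose_mat U * U)"
    unfolding gram using U'(1)
    by (simp add: assoc_mult_mat[of _ p p _ p _ p] mult_carrier_mat[of _ p p _ p])
  finally have CC: "?C * transpose_mat ?C = mat_diag p l"
    unfolding U'(2) by (simp add: left_mult_one_mat[OF mat_diag_dim] right_mult_one_mat[OF mat_diag_dim])
  have "transpose_mat ?C * ?C = transpose_mat A * (U * transpose_mat U) * A"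
    unfolding Ct using U'(1) A
    by (simp add: assoc_mult_mat[of _ n p _ p _ n] assoc_mult_mat[of _ p p _ p _ n] assoc_mult_mat[of _ n p _ p _ p])
  then have C_gram: "transpose_mat ?C * ?C = transpose_mat A * A"
    unfolding U'(3) using A by simp
  show "J \<subseteq> {..<n} \<Longrightarrow>
      (\<Sum>j\<in>J. (transpose_mat A * A) $$ (j, j)) \<le> (\<Sum>i<card J. zero_pad p l i)"
    using diagonal_gram_bound(1)[OF C CC, unfolded C_gram] decr nonneg by blast
  show "(\<Sum>j<n. (transpose_mat A * A) $$ (j, j)) = (\<Sum>i<p. l i)"
    using diagonal_gram_bound(2)[OF C CC, unfolded C_gram] decr nonneg by blast
qed

section \<open>The extremal coupling\<close>

lemma gram_append_rows:
  fixes A B :: "real mat"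
  assumes A: "A \<in> carrier_mat p n" and B: "B \<in> carrier_mat q n"
  shows "(A @\<^sub>r B) * transpose_mat (A @\<^sub>r B) = four_block_mat
      (A * transpose_mat A) (A * transpose_mat B) (B * transpose_mat A) (B * transpose_mat B)"
    and "transpose_mat (A @\<^sub>r B) * (A @\<^sub>r B) = transpose_mat A * A + transpose_mat B * B"
proof -
  have T: "transpose_mat (A @\<^sub>r B) = four_block_mat
      (transpose_mat A) (transpose_mat B) (0\<^sub>m 0 p) (0\<^sub>m 0 q)"
    unfolding append_rows_def using A B
    by (subst transpose_four_block_mat[of _ p n _ 0 _ q]) auto
  show "(A @\<^sub>r B) * transpose_mat (A @\<^sub>r B) = four_block_mat
      (A * transpose_mat A) (A * transpose_mat B) (B * transpose_mat A) (B * transpose_mat B)"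
    unfolding T unfolding append_rows_def using A B
    by (subst mult_four_block_mat[of _ p n _ 0 _ q _ _ p _ q]) auto
  have "transpose_mat (A @\<^sub>r B) * (A @\<^sub>r B) = four_block_mat
      (transpose_mat A * A + transpose_mat B * B) (0\<^sub>m n 0) (0\<^sub>m 0 n) (0\<^sub>m 0 0)"
    unfolding T unfolding append_rows_def using A B
    by (subst mult_four_block_mat[of _ n p _ q _ 0 _ _ n _ 0]) auto
  also have "\<dots> = transpose_mat A * A + transpose_mat B * B"
    using A B by (intro eq_matI) auto
  finally show "transpose_mat (A @\<^sub>r B) * (A @\<^sub>r B) = transpose_mat A * A + transpose_mat B * B" .
qed

text \<open>
  The square root of a diagonal matrix, widened by zero columns. The common width \<open>n\<close> is what
  allows the square roots of two diagonal matrices of different sizes to be multiplied and stacked.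
\<close>

definition padded_sqrt :: "nat \<Rightarrow> nat \<Rightarrow> (nat \<Rightarrow> real) \<Rightarrow> real mat" where
  "padded_sqrt p n l = mat p n (\<lambda>(i, j). if i = j then sqrt (l i) else 0)"

lemma padded_sqrt_carrier [simp]: "padded_sqrt p n l \<in> carrier_mat p n"
  by (simp add: padded_sqrt_def)

lemma padded_sqrt_gram:
  assumes "p \<le> n" and nonneg: "\<And>i. i < p \<Longrightarrow> 0 \<le> l i"
  shows "padded_sqrt p n l * transpose_mat (padded_sqrt p n l) = mat_diag p l"
    and "transpose_mat (padded_sqrt p n l) * padded_sqrt p n l = mat_diag n (zero_pad p l)"
proof -
  let ?R = "padded_sqrt p n l"
  have entry: "?R $$ (i, j) = (if i = j then sqrt (l i) else 0)" if "i < p" "j < n" for i j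
    using that by (simp add: padded_sqrt_def)
  have dim: "dim_row ?R = p" "dim_col ?R = n" by (simp_all add: padded_sqrt_def)
  show "?R * transpose_mat ?R = mat_diag p l"
  proof (rule eq_matI)
    fix i j assume "i < dim_row (mat_diag p l)" "j < dim_col (mat_diag p l)"
    then have ij: "i < p" "j < p" by (auto simp: mat_diag_def)
    have "(?R * transpose_mat ?R) $$ (i, j) = (\<Sum>k<n. ?R $$ (i, k) * ?R $$ (j, k))"
      using ij by (subst index_mult_mat_sum[of _ p n _ p]) (auto simp: dim)
    also have "\<dots> = (\<Sum>k<n. if k = i then sqrt (l i) * ?R $$ (j, i) else 0)"
      using ij by (intro sum.cong) (auto simp: entry)
    also have "\<dots> = mat_diag p l $$ (i, j)"
      using ij assms by (auto simp: entry mat_diag_def)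
    finally show "(?R * transpose_mat ?R) $$ (i, j) = mat_diag p l $$ (i, j)" .
  qed (auto simp: dim mat_diag_def)
  show "transpose_mat ?R * ?R = mat_diag n (zero_pad p l)"
  proof (rule eq_matI)
    fix i j assume "i < dim_row (mat_diag n (zero_pad p l))" "j < dim_col (mat_diag n (zero_pad p l))"
    then have ij: "i < n" "j < n" by (auto simp: mat_diag_def)
    have "(transpose_mat ?R * ?R) $$ (i, j) = (\<Sum>k<p. ?R $$ (k, i) * ?R $$ (k, j))"
      using ij by (subst index_mult_mat_sum[of _ n p _ n]) (auto simp: dim)
    also have "\<dots> = (\<Sum>k<p. if k = i then sqrt (l i) * ?R $$ (i, j) else 0)"
      using ij by (intro sum.cong) (auto simp: entry)
    also have "\<dots> = mat_diag n (zero_pad p l) $$ (i, j)"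
      using ij nonneg by (auto simp: entry mat_diag_def zero_pad_def)
    finally show "(transpose_mat ?R * ?R) $$ (i, j) = mat_diag n (zero_pad p l) $$ (i, j)" .
  qed (auto simp: dim mat_diag_def)
qed

lemma padded_sqrt_cross:
  "padded_sqrt p (p + q) l * transpose_mat (padded_sqrt q (p + q) m)
     = mat_diag p (\<lambda>i. sqrt (l i)) * upper_left_identity p q * mat_diag q (\<lambda>i. sqrt (m i))"
proof -
  let ?R = "padded_sqrt p (p + q) l" and ?S = "padded_sqrt q (p + q) m"
  have carrier: "mat p q f \<in> carrier_mat p q" for f :: "nat \<times> nat \<Rightarrow> real" by simp
  have rhs: "mat_diag p (\<lambda>i. sqrt (l i)) * upper_left_identity p q * mat_diag q (\<lambda>i. sqrt (m i))
      = mat p q (\<lambda>(i, j). if i = j then sqrt (l i) * sqrt (m j) else 0)"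
    unfolding upper_left_identity_def mat_diag_mult_left[OF carrier] mat_diag_mult_right[OF carrier]
    by (rule eq_matI) auto
  show ?thesis
  proof (unfold rhs, rule eq_matI, goal_cases)
    case (1 i j)
    then have ij: "i < p" "j < q" by auto
    have "(?R * transpose_mat ?S) $$ (i, j) = (\<Sum>k<p + q. ?R $$ (i, k) * ?S $$ (j, k))"
      using ij by (subst index_mult_mat_sum[of _ p "p + q" _ q]) (auto simp: padded_sqrt_def)
    also have "\<dots> = (\<Sum>k<p + q. if k = i then sqrt (l i) * ?S $$ (j, i) else 0)"
      using ij by (intro sum.cong) (auto simp: padded_sqrt_def)
    also have "\<dots> = (if i = j then sqrt (l i) * sqrt (m j) else 0)"
      using ij by (auto simp: padded_sqrt_def)
    finally show ?case using ij by simp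
  qed (auto simp: padded_sqrt_def)
qed

text \<open>
  The block matrix is \<open>X * X\<^sup>T\<close> for \<open>X\<close> with blocks \<open>U * R\<close> above \<open>V * S\<close>, where \<open>R\<close> and \<open>S\<close> are the
  widened square roots of the two diagonal matrices. In \<open>X\<^sup>T * X\<close> the orthogonal factors cancel, and what
  remains is the sum of the two padded diagonal matrices.
\<close>

lemma eigvals_comonotone_coupling:
  assumes U: "U \<in> orthonormal_mat p" and V: "V \<in> orthonormal_mat q"
    and l: "\<And>i j. i \<le> j \<Longrightarrow> j < p \<Longrightarrow> l j \<le> l i" "\<And>i. i < p \<Longrightarrow> 0 \<le> l i"
    and m: "\<And>i j. i \<le> j \<Longrightarrow> j < q \<Longrightarrow> m j \<le> m i" "\<And>i. i < q \<Longrightarrow> 0 \<le> m i"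
    and Psi: "Psi = U * mat_diag p (\<lambda>i. sqrt (l i)) * upper_left_identity p q
           * mat_diag q (\<lambda>i. sqrt (m i)) * transpose_mat V"
  shows "eigvals (four_block_mat (U * mat_diag p l * transpose_mat U) Psi (transpose_mat Psi)
      (V * mat_diag q m * transpose_mat V)) = map (\<lambda>j. zero_pad p l j + zero_pad q m j) [0..<p + q]"
proof -
  let ?n = "p + q"
  let ?R = "padded_sqrt p ?n l" and ?S = "padded_sqrt q ?n m"
  note U' = orthonormal_matD[OF U] and V' = orthonormal_matD[OF V]
  define A where "A = U * ?R"
  define B where "B = V * ?S"
  have A: "A \<in> carrier_mat p ?n" and B: "B \<in> carrier_mat q ?n"
    using U' V' mult_carrier_mat padded_sqrt_carrier unfolding A_def B_def by blast+
  have At: "transpose_mat A = transpose_mat ?R * transpose_mat U"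
    unfolding A_def using U' by (simp add: transpose_mult[of _ p p _ ?n])
  have Bt: "transpose_mat B = transpose_mat ?S * transpose_mat V"
    unfolding B_def using V' by (simp add: transpose_mult[of _ q q _ ?n])
  have conj: "(M * F) * (transpose_mat G * transpose_mat N) = M * (F * transpose_mat G) * transpose_mat N"
    if "M \<in> carrier_mat a a" "N \<in> carrier_mat b b" "F \<in> carrier_mat a ?n" "G \<in> carrier_mat b ?n"
    for M N F G :: "real mat" and a b
    using that by (simp add: assoc_mult_mat[of _ a a _ ?n _ b] assoc_mult_mat[of _ a ?n _ b _ b]
        assoc_mult_mat[of _ a a _ b _ b] mult_carrier_mat[of _ a ?n _ b] mult_carrier_mat[of _ ?n b _ b])
  have gram: "transpose_mat F * transpose_mat M * (M * F) = transpose_mat F * F"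
    if M: "M \<in> carrier_mat a a" "transpose_mat M * M = 1\<^sub>m a" and F: "F \<in> carrier_mat a ?n"
    for M F :: "real mat" and a
  proof -
    have "transpose_mat F * transpose_mat M * (M * F) = transpose_mat F * ((transpose_mat M * M) * F)"
      using M(1) F by (simp add: assoc_mult_mat[of _ ?n a _ a _ ?n] assoc_mult_mat[of _ a a _ a _ ?n]
          mult_carrier_mat[of _ a a _ ?n])
    then show ?thesis using M(2) F by simp
  qed
  have AA: "A * transpose_mat A = U * mat_diag p l * transpose_mat U"
    unfolding At unfolding A_def
    using conj[of U p U p ?R ?R] U' padded_sqrt_gram(1)[of p ?n l] l(2) by simp
  have BB: "B * transpose_mat B = V * mat_diag q m * transpose_mat V"
    unfolding Bt unfolding B_def
    using conj[of V q V q ?S ?S] V' padded_sqrt_gram(1)[of q ?n m] m(2) by simp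
  have AB: "A * transpose_mat B = Psi"
  proof -
    have Pi: "upper_left_identity p q \<in> carrier_mat p q" by (simp add: upper_left_identity_def)
    have "A * transpose_mat B = U * (?R * transpose_mat ?S) * transpose_mat V"
      unfolding Bt unfolding A_def using conj[of U p V q ?R ?S] U' V' by simp
    then show ?thesis
      unfolding Psi padded_sqrt_cross using U'(1) Pi 
      by (simp add: assoc_mult_mat[of _ p p _ p _ q] assoc_mult_mat[of _ p p _ q _ q]
        mult_carrier_mat[of _ p p _ q] mult_carrier_mat[of _ p q _ q])
  qed
  have BA: "B * transpose_mat A = transpose_mat Psi"
    unfolding AB[symmetric] using A B by (simp add: transpose_mult[of _ p ?n _ q])
  let ?X = "A @\<^sub>r B" and ?l = "\<lambda>j. zero_pad p l j + zero_pad q m j"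
  have X: "?X \<in> carrier_mat ?n ?n" using A B by simp
  have "transpose_mat A * A = mat_diag ?n (zero_pad p l)"
    unfolding At unfolding A_def using gram[of U p ?R] U' padded_sqrt_gram(2)[of p ?n l] l(2) by simp
  moreover have "transpose_mat B * B = mat_diag ?n (zero_pad q m)"
    unfolding Bt unfolding B_def using gram[of V q ?S] V' padded_sqrt_gram(2)[of q ?n m] m(2) by simp
  moreover have "mat_diag ?n (zero_pad p l) + mat_diag ?n (zero_pad q m) = mat_diag ?n ?l"
    by (rule eq_matI) (auto simp: mat_diag_def)
  ultimately have "transpose_mat ?X * ?X = mat_diag ?n ?l"
    using gram_append_rows(2)[OF A B] by simp
  then have "eigvals (?X * transpose_mat ?X) = rev (sort (map ?l [0..<?n]))"
    by (rule eigvals_gram[OF X])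
  also have "\<dots> = map ?l [0..<?n]"
  proof -
    have "zero_pad p l j \<le> zero_pad p l i" "zero_pad q m j \<le> zero_pad q m i" if "i \<le> j" for i j
      using l m that by (auto simp: zero_pad_def)
    then have "sorted (rev (map ?l [0..<?n]))"
      by (auto simp: sorted_iff_nth_mono rev_nth intro!: add_mono)
    then have "sort (map ?l [0..<?n]) = rev (map ?l [0..<?n])"
      by (intro properties_for_sort) auto
    then show ?thesis by simp
  qed
  finally show ?thesis
    unfolding gram_append_rows(1)[OF A B] AA AB BA BB .
qed

section \<open>Majorization\<close>

lemma decreasing_eigvals: "decreasing (eigvals A) = eigvals A"
  unfolding decreasing_def eigvals_def by (simp flip: sorted_list_of_multiset_mset)

lemma sum_take_decreasing:
  assumes "k \<le> n"
  obtains J where "J \<subseteq> {..<n}" "card J = k" "(\<Sum>i<k. rev (sort (map l [0..<n])) ! i) = sum l J"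
proof -
  have "mset (rev (sort (map l [0..<n]))) = mset (map l [0..<n])" by simp
  then obtain f where f: "f permutes {..<n}"
    and perm: "permute_list f (map l [0..<n]) = rev (sort (map l [0..<n]))"
    by (metis mset_eq_permutation length_map length_upt diff_zero)
  have inj: "inj_on f {..<k}" using permutes_inj[OF f] by (rule inj_on_subset) simp
  have bound: "f i < n" if "i < k" for i
    using permutes_in_image[OF f, of i] that assms by auto
  show thesis
  proof (rule that[of "f ` {..<k}"])
    show "f ` {..<k} \<subseteq> {..<n}" using bound by auto
    show "card (f ` {..<k}) = k" using card_image[OF inj] by simp
    show "(\<Sum>i<k. rev (sort (map l [0..<n])) ! i) = sum l (f ` {..<k})"
      unfolding perm[symmetric] sum.reindex[OF inj]
      using f bound assms by (intro sum.cong) (auto simp: permute_list_nth)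
  qed
qed

text \<open>
  Factor \<open>S = X * X\<^sup>T\<close> with \<open>X\<^sup>T * X\<close> diagonal and split \<open>X\<close> into its upper rows \<open>A\<close> and lower rows \<open>B\<close>.
  The diagonal blocks say \<open>A * A\<^sup>T = S1\<close> and \<open>B * B\<^sup>T = S2\<close>, while each eigenvalue of \<open>S\<close> is the sum of a
  diagonal entry of \<open>A\<^sup>T * A\<close> and one of \<open>B\<^sup>T * B\<close>. Over any \<open>k\<close> indices, either kind of entry sums
  to at most the sum of the \<open>k\<close> largest eigenvalues of the respective block.
\<close>

lemma coupling_majorized:
  assumes S: "S \<in> coupling_set p q S1 S2"
    and U: "U \<in> orthonormal_mat p" and V: "V \<in> orthonormal_mat q"
    and S1: "S1 = U * mat_diag p l * transpose_mat U"
    and S2: "S2 = V * mat_diag q m * transpose_mat V"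
    and l: "\<And>i j. i \<le> j \<Longrightarrow> j < p \<Longrightarrow> l j \<le> l i" "\<And>i. i < p \<Longrightarrow> 0 \<le> l i"
    and m: "\<And>i j. i \<le> j \<Longrightarrow> j < q \<Longrightarrow> m j \<le> m i" "\<And>i. i < q \<Longrightarrow> 0 \<le> m i"
    and T: "eigvals T = map (\<lambda>j. zero_pad p l j + zero_pad q m j) [0..<p + q]"
  shows "eigvals S \<prec>\<^sub>m eigvals T"
proof -
  let ?n = "p + q"
  obtain Psi where psd: "S \<in> psd_mat ?n" and Psi: "Psi \<in> carrier_mat p q"
    and S_block: "S = four_block_mat S1 Psi (transpose_mat Psi) S2"
    using S by (auto simp: coupling_set_def)
  obtain X a where X: "X \<in> carrier_mat ?n ?n" and S_gram: "S = X * transpose_mat X"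
    and X_diag: "transpose_mat X * X = mat_diag ?n a"
    using psd_mat_gram[OF psd] by blast
  define A where "A = mat p ?n (\<lambda>(i, j). X $$ (i, j))"
  define B where "B = mat q ?n (\<lambda>(i, j). X $$ (i + p, j))"
  have A: "A \<in> carrier_mat p ?n" and B: "B \<in> carrier_mat q ?n"
    by (simp_all add: A_def B_def)
  have X_eq: "X = A @\<^sub>r B"
    using X by (auto intro!: eq_matI simp: append_rows_def A_def B_def)
  have S1c: "S1 \<in> carrier_mat p p" and S2c: "S2 \<in> carrier_mat q q"
    using mult_carrier_mat[OF mult_carrier_mat[OF orthonormal_matD(1)[OF U] mat_diag_dim]]
      mult_carrier_mat[OF mult_carrier_mat[OF orthonormal_matD(1)[OF V] mat_diag_dim]]
      orthonormal_matD(1)[OF U] orthonormal_matD(1)[OF V]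
    unfolding S1 S2 by auto
  have blocks: "four_block_mat S1 Psi (transpose_mat Psi) S2 = four_block_mat
      (A * transpose_mat A) (A * transpose_mat B) (B * transpose_mat A) (B * transpose_mat B)"
    using S_block S_gram gram_append_rows(1)[OF A B] X_eq by simp
  have AA: "A * transpose_mat A = S1"
  proof (rule eq_matI)
    fix i j assume "i < dim_row S1" "j < dim_col S1"
    then show "(A * transpose_mat A) $$ (i, j) = S1 $$ (i, j)"
      using arg_cong[OF blocks, of "\<lambda>M. M $$ (i, j)"] A B S1c S2c by simp
  qed (use A S1c in auto)
  have BB: "B * transpose_mat B = S2"
  proof (rule eq_matI)
    fix i j assume "i < dim_row S2" "j < dim_col S2"
    then show "(B * transpose_mat B) $$ (i, j) = S2 $$ (i, j)"
      using arg_cong[OF blocks, of "\<lambda>M. M $$ (p + i, p + j)"] A B S1c S2c by simp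
  qed (use B S2c in auto)
  have a: "a j = (transpose_mat A * A) $$ (j, j) + (transpose_mat B * B) $$ (j, j)" if "j < ?n" for j
    using arg_cong[OF trans[OF X_diag[symmetric, unfolded X_eq] gram_append_rows(2)[OF A B]],
        of "\<lambda>M. M $$ (j, j)"] that A B
    by (simp add: mat_diag_def del: index_mult_mat(1))
  have topA: "(\<Sum>j\<in>J. (transpose_mat A * A) $$ (j, j)) \<le> (\<Sum>i<card J. zero_pad p l i)"
    and topB: "(\<Sum>j\<in>J. (transpose_mat B * B) $$ (j, j)) \<le> (\<Sum>i<card J. zero_pad q m i)"
    if "J \<subseteq> {..<?n}" for J
    using diagonal_gram_bound_conj(1)[OF A U AA[unfolded S1]] l
      diagonal_gram_bound_conj(1)[OF B V BB[unfolded S2]] m that by blast+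
  have totalA: "(\<Sum>j<?n. (transpose_mat A * A) $$ (j, j)) = (\<Sum>i<p. l i)"
    and totalB: "(\<Sum>j<?n. (transpose_mat B * B) $$ (j, j)) = (\<Sum>i<q. m i)"
    using diagonal_gram_bound_conj(2)[OF A U AA[unfolded S1]] l
      diagonal_gram_bound_conj(2)[OF B V BB[unfolded S2]] m by blast+
  have eigS: "eigvals S = rev (sort (map a [0..<?n]))"
    unfolding S_gram by (rule eigvals_gram[OF X X_diag])
  have top: "(\<Sum>i<k. eigvals S ! i) \<le> (\<Sum>i<k. eigvals T ! i)" if k: "k \<le> ?n" for k
  proof -
    obtain J where J: "J \<subseteq> {..<?n}" "card J = k" "(\<Sum>i<k. eigvals S ! i) = sum a J"
      using sum_take_decreasing[OF k, of a] unfolding eigS by blast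
    have "sum a J = (\<Sum>j\<in>J. (transpose_mat A * A) $$ (j, j)) + (\<Sum>j\<in>J. (transpose_mat B * B) $$ (j, j))"
      unfolding sum.distrib[symmetric] using J(1) by (intro sum.cong a) auto
    also have "\<dots> \<le> (\<Sum>i<k. zero_pad p l i) + (\<Sum>i<k. zero_pad q m i)"
      using topA[OF J(1)] topB[OF J(1)] J(2) by simp
    also have "\<dots> = (\<Sum>i<k. eigvals T ! i)"
      unfolding T using k by (simp add: sum.distrib)
    finally show ?thesis using J(3) by simp
  qed
  have total: "(\<Sum>i<?n. eigvals S ! i) = (\<Sum>i<?n. eigvals T ! i)"
  proof -
    have pad: "(\<Sum>i<n. zero_pad r f i) = (\<Sum>i<r. f i)" if "r \<le> n" for n r f
      using that by (intro sum.mono_neutral_cong_right) (auto simp: zero_pad_def)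
    obtain J where J: "J \<subseteq> {..<?n}" "card J = ?n" "(\<Sum>i<?n. eigvals S ! i) = sum a J"
      using sum_take_decreasing[OF order_refl, of ?n a] unfolding eigS by blast
    then have "J = {..<?n}" by (intro card_subset_eq) auto
    then have "(\<Sum>i<?n. eigvals S ! i) = (\<Sum>j<?n. a j)" using J(3) by simp
    also have "\<dots> = (\<Sum>i<p. l i) + (\<Sum>i<q. m i)"
      unfolding totalA[symmetric] totalB[symmetric] sum.distrib[symmetric]
      by (intro sum.cong a) auto
    also have "\<dots> = (\<Sum>i<?n. eigvals T ! i)"
      unfolding T by (simp add: sum.distrib pad)
    finally show ?thesis .
  qed
  have "length (eigvals S) = ?n" "length (eigvals T) = ?n" unfolding eigS T by simp_all
  then show ?thesis
    unfolding majorized_def decreasing_eigvals using top total by simp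
qed

theorem theorem3p6:
  fixes p q :: nat
    and S1 S2 U1 U2 Psi_m Sigma_m :: "real mat"
    and l1 l2 :: "nat \<Rightarrow> real"
  assumes "p \<ge> 1" and "q \<ge> 1"
    and "S1 \<in> psd_mat p" and "S2 \<in> psd_mat q"
    and "U1 \<in> orthonormal_mat p" and "U2 \<in> orthonormal_mat q"
    and "\<And>i j. i \<le> j \<Longrightarrow> j < p \<Longrightarrow> l1 j \<le> l1 i" and "\<And>i. i < p \<Longrightarrow> 0 \<le> l1 i"
    and "\<And>i j. i \<le> j \<Longrightarrow> j < q \<Longrightarrow> l2 j \<le> l2 i" and "\<And>i. i < q \<Longrightarrow> 0 \<le> l2 i"
    and "S1 = U1 * mat_diag p l1 * transpose_mat U1"
    and "S2 = U2 * mat_diag q l2 * transpose_mat U2"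
    and "Psi_m = U1 * mat_diag p (\<lambda>i. sqrt (l1 i)) * upper_left_identity p q
           * mat_diag q (\<lambda>i. sqrt (l2 i)) * transpose_mat U2"
    and "Sigma_m = four_block_mat S1 Psi_m (transpose_mat Psi_m) S2"
  shows "eigvals Sigma_m =
           map (\<lambda>j. (if j < p then l1 j else 0) + (if j < q then l2 j else 0)) [0..<p + q]
         \<and> (\<forall>S \<in> coupling_set p q S1 S2. eigvals S \<prec>\<^sub>m eigvals Sigma_m)"
proof -
  have "eigvals Sigma_m = map (\<lambda>j. zero_pad p l1 j + zero_pad q l2 j) [0..<p + q]"
    unfolding assms(14) assms(11,12)
    using eigvals_comonotone_coupling[OF assms(5-10) assms(13)] .
  moreover from this have "eigvals S \<prec>\<^sub>m eigvals Sigma_m" if "S \<in> coupling_set p q S1 S2" for S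
    using coupling_majorized[OF that assms(5,6,11,12,7-10)] by blast
  ultimately show ?thesis by (simp add: zero_pad_def)
qed

end
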